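(* Let $0<U_0<1$ and $V_0>0$ (case $\varepsilon=0$). Let $m_1,m_2\ge2$ and, for $i=1,2$, suppose that $f_{m_i}$ with free-boundary position $a_{m_i}$ satisfies the following problem with $m=m_i$, $f=f_{m_i}$, $a=a_{m_i}$: $$\begin{aligned} &-\tfrac12\eta f'(\eta)=[f^{m-1}(\eta)f'(\eta)]' &&\text{if }-\infty<\eta<a,\\ &f(\eta)=-V_0 &&\text{if }a<\eta<\infty,\\ &\lim_{\eta\to-\infty}f(\eta)=U_0,\qquad \lim_{\eta\nearrow a}f(\eta)=0,\\ &\lim_{\eta\nearrow a}f^{m-1}(\eta)f'(\eta)=-\frac{aV_0}{2}. \end{aligned}$$ If $m_1>m_2$, then $0<a_{m_1}<a_{m_2}$.
   Context: A prime denotes differentiation with respect to $\eta$, and $f^{m-1}(\eta)$ means $(f(\eta))^{m-1}$. The position $a>0$ is part of the solution; solutions are classical: $f$ is positive and $C^2$ on $(-\infty,a)$. The same $U_0$ and $V_0$ are used for $m_1$ and $m_2$. *)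

theory Defs
  imports "HOL-Analysis.Analysis"
begin

(* Only meant for open sets S, where the two-sided deriv is the right derivative. *)
definition C2_on_open :: "real set \<Rightarrow> (real \<Rightarrow> real) \<Rightarrow> bool" where
  "C2_on_open S f \<longleftrightarrow>
     (\<forall>x\<in>S. f differentiable (at x)) \<and>
     (\<forall>x\<in>S. deriv f differentiable (at x)) \<and>
     continuous_on S (deriv (deriv f))"

(* The exponent m is real; powr is the usual real power here because it is only applied
   to f on (-infinity, a), where f is positive. The value f a is left unconstrained. *)
definition free_boundary_solution ::
    "real \<Rightarrow> real \<Rightarrow> real \<Rightarrow> (real \<Rightarrow> real) \<Rightarrow> real \<Rightarrow> bool" where
  "free_boundary_solution U0 V0 m f a \<longleftrightarrow>
     0 < a \<and>
     (\<forall>\<eta><a. 0 < f \<eta>) \<and>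
     C2_on_open {..<a} f \<and>
     (\<forall>\<eta><a. - (1/2) * \<eta> * deriv f \<eta> = deriv (\<lambda>x. f x powr (m - 1) * deriv f x) \<eta>) \<and>
     (\<forall>\<eta>>a. f \<eta> = - V0) \<and>
     (f \<longlongrightarrow> U0) at_bot \<and>
     (f \<longlongrightarrow> 0) (at_left a) \<and>
     ((\<lambda>\<eta>. f \<eta> powr (m - 1) * deriv f \<eta>) \<longlongrightarrow> - (a * V0 / 2)) (at_left a)"

end

theory Submission
  imports Defs
begin

text \<open>
  The equation is solved in hodograph form. On \<open>(-\<infinity>, a)\<close> the flux \<open>f\<^sup>m\<^sup>-\<^sup>1 f'\<close> is negative, so
  \<open>f\<close> decreases and has an inverse \<open>g\<close> on \<open>(0, U0)\<close>. With \<open>q(u)\<close> the negated flux at the point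
  where \<open>f = u\<close>, the problem becomes \<open>q' = g/2\<close>, \<open>g' = - u\<^sup>m\<^sup>-\<^sup>1 / q\<close>, that is
  \<open>q'' = - u\<^sup>m\<^sup>-\<^sup>1 / (2 q)\<close>, with \<open>q(0) = a V0 / 2\<close>, \<open>q'(0) = a / 2\<close> and \<open>q(U0) = 0\<close>.
  If \<open>a1 \<ge> a2\<close>, the difference \<open>d = q1 - q2\<close> satisfies \<open>d(0) \<ge> 0\<close>, \<open>d'(0) \<ge> 0\<close> and
  \<open>d(U0) = 0\<close>. Since \<open>u < 1\<close>, \<open>d'' > 0\<close> wherever \<open>d \<ge> 0\<close>, and also near \<open>0\<close>. Hence \<open>d\<close> becomes
  positive near \<open>0\<close> and must have a positive interior maximum, where \<open>d'' > 0\<close>: a contradiction.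
\<close>

text \<open>A Gronwall argument: if \<open>K\<close> bounds \<open>c\<close> from above on
  \<open>{x..b}\<close>, the weighted square of \<open>w\<close> by \<open>exp (- 2 * K * y)\<close>
  is nonincreasing and nonnegative, so it stays 0 once it is 0.\<close>

lemma linear_ode_zero_propagates:
  fixes w c :: "real \<Rightarrow> real"
  assumes "x \<le> b"
    and deriv: "\<And>y. x \<le> y \<Longrightarrow> y \<le> b \<Longrightarrow> (w has_real_derivative c y * w y) (at y)"
    and cont: "continuous_on {x..b} c"
    and "w x = 0"
  shows "w b = 0"
proof -
  obtain K where K: "\<And>y. x \<le> y \<Longrightarrow> y \<le> b \<Longrightarrow> c y \<le> K"
    using continuous_attains_sup[OF compact_Icc _ cont] \<open>x \<le> b\<close> by fastforce
  define E where "E y = (w y)\<^sup>2 * exp (- 2 * K * y)" for y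
  have "E b \<le> E x"
  proof (rule DERIV_nonpos_imp_nonincreasing[OF \<open>x \<le> b\<close>])
    fix y assume y: "x \<le> y" "y \<le> b"
    have "(E has_real_derivative (c y - K) * (2 * (w y)\<^sup>2 * exp (- 2 * K * y))) (at y)"
      unfolding E_def
      by (rule derivative_eq_intros deriv y refl)+ (simp add: algebra_simps power2_eq_square)
    moreover have "(c y - K) * (2 * (w y)\<^sup>2 * exp (- 2 * K * y)) \<le> 0"
      using K[OF y] by (intro mult_nonpos_nonneg) auto
    ultimately show "\<exists>D. (E has_real_derivative D) (at y) \<and> D \<le> 0" by blast
  qed
  then have "(w b)\<^sup>2 \<le> 0"
    using \<open>w x = 0\<close> by (simp add: E_def mult_le_0_iff)
  then show ?thesis by simp
qed

text \<open>Strict monotonicity puts \<open>L\<close> below \<open>h (x/2)\<close>, which is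
  strictly below \<open>h x\<close>. The boundary datum is a one-sided limit because the transformed
  functions are not controlled at 0 itself.\<close>

lemma pos_of_deriv_pos_at_right_0:
  fixes h h' :: "real \<Rightarrow> real"
  assumes lim: "(h \<longlongrightarrow> L) (at_right 0)" and "0 \<le> L"
    and deriv: "\<And>x. 0 < x \<Longrightarrow> x < r \<Longrightarrow> (h has_real_derivative h' x) (at x)"
    and pos: "\<And>x. 0 < x \<Longrightarrow> x < r \<Longrightarrow> 0 < h' x"
    and x: "0 < x" "x < r"
  shows "0 < h x"
proof -
  have mono: "h y < h z" if "0 < y" "y < z" "z < r" for y z
    by (rule DERIV_pos_imp_increasing[OF \<open>y < z\<close>]) (use deriv pos that in force)
  have "eventually (\<lambda>y. h y \<le> h (x/2)) (at_right 0)"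
    unfolding eventually_at_right_field
    using mono[of _ "x/2"] x by (intro exI[of _ "x/2"]) force
  then have "L \<le> h (x/2)"
    using tendsto_upperbound[OF lim] by simp
  also have "\<dots> < h x" using mono[of "x/2" x] x by simp
  finally show ?thesis using \<open>0 \<le> L\<close> by simp
qed

text \<open>At a maximum \<open>d'\<close> vanishes, and \<open>D > 0\<close> makes
  \<open>d'\<close> positive just to the right, so \<open>d\<close> would rise beyond its maximum. A
  second derivative is required at \<open>z\<close> only.\<close>

lemma no_interior_max:
  fixes d d' :: "real \<Rightarrow> real"
  assumes deriv: "\<And>x. l < x \<Longrightarrow> x < r \<Longrightarrow> (d has_real_derivative d' x) (at x)"
    and deriv2: "(d' has_real_derivative D) (at z)" and "0 < D"
    and z: "l < z" "z < r"
    and max: "\<And>x. l < x \<Longrightarrow> x < r \<Longrightarrow> d x \<le> d z"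
  shows False
proof -
  have "d' z = 0"
    using DERIV_local_max[OF deriv[OF z], of "min (z - l) (r - z)"] max z
    by (auto simp: abs_if split: if_splits)
  obtain e where "0 < e" and e: "\<And>h. 0 < h \<Longrightarrow> h < e \<Longrightarrow> d' z < d' (z + h)"
    using DERIV_pos_inc_right[OF deriv2 \<open>0 < D\<close>] by blast
  define h where "h = min (e/2) ((r - z)/2)"
  have h: "0 < h" "h < e" "z + h < r"
    using \<open>0 < e\<close> z by (auto simp: h_def min_def field_simps)
  obtain y where y: "z < y" "y < z + h" "d (z + h) - d z = (z + h - z) * d' y"
    using MVT2[of z "z + h" d d'] deriv h z by force
  have "0 < d' y" using e[of "y - z"] y h \<open>d' z = 0\<close> by simp
  then have "0 < h * d' y" using h by simp
  then have "d z < d (z + h)" using y(3) by simp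
  with max[of "z + h"] h z show False by simp
qed

text \<open>Taking \<open>u = f x\<close> as the independent variable moves the unknown boundary
  \<open>a\<close> to the fixed endpoint \<open>u = 0\<close>, so two solutions can be compared on
  the same interval. The position \<open>a\<close> survives only in the limits at 0.\<close>

lemma hodograph:
  assumes "0 < U0" "U0 < 1" "0 < V0"
    and sol: "free_boundary_solution U0 V0 m f a" and "2 \<le> m"
  obtains g q where
    "\<And>u. 0 < u \<Longrightarrow> u < U0 \<Longrightarrow> 0 < q u"
    "\<And>u. 0 < u \<Longrightarrow> u < U0 \<Longrightarrow> (q has_real_derivative g u / 2) (at u)"
    "\<And>u. 0 < u \<Longrightarrow> u < U0 \<Longrightarrow> (g has_real_derivative - (u powr (m - 1) / q u)) (at u)"
    "(g \<longlongrightarrow> a) (at_right 0)"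
    "(q \<longlongrightarrow> a * V0 / 2) (at_right 0)"
    "(q \<longlongrightarrow> 0) (at_left U0)"
proof -

  \<comment> \<open>Regularity of \<open>f\<close> and of its flux \<open>w\<close>\<close>
  define w where "w = (\<lambda>x. f x powr (m - 1) * deriv f x)"
  have "0 < a" and fpos: "\<And>x. x < a \<Longrightarrow> 0 < f x"
    and lim_bot: "(f \<longlongrightarrow> U0) at_bot" and lim_a: "(f \<longlongrightarrow> 0) (at_left a)"
    and lim_w: "(w \<longlongrightarrow> - (a * V0 / 2)) (at_left a)"
    and C2: "C2_on_open {..<a} f"
    and ode: "\<And>x. x < a \<Longrightarrow> deriv w x = - (1/2) * x * deriv f x"
    using sol unfolding free_boundary_solution_def w_def by auto
  have df: "(f has_real_derivative deriv f x) (at x)" if "x < a" for x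
    using C2 that unfolding C2_on_open_def
    by (simp add: DERIV_deriv_iff_real_differentiable)
  have ddf: "(deriv f has_real_derivative deriv (deriv f) x) (at x)" if "x < a" for x
    using C2 that unfolding C2_on_open_def
    by (simp add: DERIV_deriv_iff_real_differentiable)
  have dw: "(w has_real_derivative - (1/2) * x * deriv f x) (at x)" if "x < a" for x
  proof -
    have "(\<lambda>x. f x powr (m - 1)) differentiable at x"
      using DERIV_powr[OF df[OF that] fpos[OF that] DERIV_const] real_differentiable_def by blast
    then have "w differentiable at x"
      unfolding w_def using ddf[OF that] real_differentiable_def
      by (intro differentiable_mult) blast+
    then show ?thesis
      using ode[OF that] by (simp flip: DERIV_deriv_iff_real_differentiable)
  qed
  have cont_f: "continuous_on {..<a} f"
    using df by (intro DERIV_continuous_on) (auto intro: has_field_derivative_at_within)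
  have cont_w: "continuous_on {..<a} w"
    using dw by (intro DERIV_continuous_on) (auto intro: has_field_derivative_at_within)

  \<comment> \<open>Since \<open>f > 0\<close>, \<open>deriv f\<close> equals \<open>w\<close>
    divided by \<open>f powr (m - 1)\<close>, which makes the equation linear in
    \<open>w\<close>.\<close>
  define c where "c = (\<lambda>x. - (1/2) * x / f x powr (m - 1))"
  have dw': "(w has_real_derivative c x * w x) (at x)" if "x < a" for x
    using dw[OF that] fpos[OF that] by (simp add: c_def w_def)
  have cont_c: "continuous_on {x..b} c" if "b < a" for x b
  proof -
    have "f y \<noteq> 0" if "y \<le> b" for y
      using fpos[of y] \<open>b < a\<close> that by simp
    then show ?thesis
      unfolding c_def using that
      by (intro continuous_intros continuous_on_subset[OF cont_f]) auto
  qed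

  \<comment> \<open>Sign of the flux and monotonicity of \<open>f\<close>\<close>
  have ev_neg: "eventually (\<lambda>x. w x < 0) (at_left a)"
    using order_tendstoD(2)[OF lim_w, of 0] \<open>0 < a\<close> \<open>0 < V0\<close> by simp
  have near_a: "\<exists>b. x < b \<and> b < a \<and> P b" if "x < a" "eventually P (at_left a)" for x P
  proof -
    have "eventually (\<lambda>b. b \<in> {x<..<a} \<and> P b) (at_left a)"
      by (intro eventually_conj eventually_at_left_real that)
    then show ?thesis
      using eventually_happens'[of "at_left a"] by auto
  qed
  \<comment> \<open>A zero of the flux would propagate to the right, up to points near
    \<open>a\<close> where the flux is already known to be negative.\<close>
  have w_nz: "w x \<noteq> 0" if "x < a" for x
  proof
    assume "w x = 0"
    obtain b where "x < b" "b < a" "w b < 0" using near_a[OF \<open>x < a\<close> ev_neg] by blast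
    moreover have "w b = 0"
      using linear_ode_zero_propagates[of x b w c] dw' cont_c \<open>w x = 0\<close> \<open>x < b\<close> \<open>b < a\<close> by simp
    ultimately show False by simp
  qed
  have w_neg: "w x < 0" if "x < a" for x
  proof (rule ccontr)
    assume "\<not> w x < 0"
    obtain b where "x < b" "b < a" "w b < 0" using near_a[OF \<open>x < a\<close> ev_neg] by blast
    then obtain y where "x \<le> y" "y \<le> b" "w y = 0"
      using IVT2'[of w b 0 x] \<open>\<not> w x < 0\<close> continuous_on_subset[OF cont_w, of "{x..b}"] by force
    then show False using w_nz \<open>b < a\<close> by force
  qed
  have f'_neg: "deriv f x < 0" if "x < a" for x
    using w_neg[OF that] fpos[OF that] by (simp add: w_def mult_less_0_iff)
  have f_dec: "f y < f x" if "x < y" "y < a" for x y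
  proof (rule DERIV_neg_imp_decreasing[OF \<open>x < y\<close>])
    fix z assume "z \<le> y"
    then have "z < a" using \<open>y < a\<close> by simp
    then show "\<exists>D. (f has_real_derivative D) (at z) \<and> D < 0"
      using df f'_neg by blast
  qed
  have f_less: "f x < U0" if "x < a" for x
  proof -
    \<comment> \<open>The detour through \<open>x - 1\<close> keeps the inequality strict: passing
      to the limit alone yields only a weak bound.\<close>
    have "eventually (\<lambda>y. f (x - 1) \<le> f y) at_bot"
      using eventually_le_at_bot[of "x - 1"]
      by eventually_elim (use f_dec that in \<open>force simp: le_less\<close>)
    then have "f (x - 1) \<le> U0" using tendsto_lowerbound[OF lim_bot] by simp
    then show ?thesis using f_dec[of "x - 1" x] that by simp
  qed

  \<comment> \<open>The inverse \<open>g\<close> of \<open>f\<close> on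
    \<open>(0, U0)\<close>\<close>
  have surj: "\<exists>x<a. f x = u" if "0 < u" "u < U0" for u
  proof -
    obtain x where "x < a" "u < f x"
      using eventually_happens'[OF _ eventually_conj[OF order_tendstoD(1)[OF lim_bot \<open>u < U0\<close>]
          eventually_gt_at_bot[of a]]] by (auto simp: trivial_limit_at_bot_linorder)
    moreover obtain b where "x < b" "b < a" "f b < u"
      using near_a[OF \<open>x < a\<close> order_tendstoD(2)[OF lim_a \<open>0 < u\<close>]] by blast
    ultimately obtain y where "x \<le> y" "y \<le> b" "f y = u"
      using IVT2'[of f b u x] continuous_on_subset[OF cont_f, of "{x..b}"] by force
    then show ?thesis using \<open>b < a\<close> by (intro exI[of _ y]) simp
  qed
  have f_less_iff: "f x < f y \<longleftrightarrow> y < x" if "x < a" "y < a" for x y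
    using f_dec that by (metis less_asym linorder_neqE)
  then have inj: "inj_on f {..<a}"
    by (intro inj_onI) (metis lessThan_iff less_irrefl linorder_neqE)
  define g where "g = the_inv_into {..<a} f"
  define q where "q u = - w (g u)" for u
  have gf: "g (f x) = x" if "x < a" for x
    using inj that by (simp add: g_def the_inv_into_f_f)
  have ga: "g u < a" and fg: "f (g u) = u" if "0 < u" "u < U0" for u
  proof -
    obtain x where "x < a" "f x = u" using surj \<open>0 < u\<close> \<open>u < U0\<close> by blast
    then show "g u < a" "f (g u) = u" using gf[of x] by simp_all
  qed
  have dg: "(g has_real_derivative inverse (deriv f (g u))) (at u)" if "0 < u" "u < U0" for u
  proof (rule DERIV_inverse_function[where f = f and a = 0 and b = U0])
    show "(f has_real_derivative deriv f (g u)) (at (g u))" using df ga that by simp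
    show "deriv f (g u) \<noteq> 0" using f'_neg[OF ga[OF that]] by simp
    have "isCont g (f (g u))"
      \<comment> \<open>The midpoint \<open>(g u + a) / 2\<close> serves as right end so that the
        interval around \<open>g u\<close> stays to the left of \<open>a\<close>.\<close>
      by (rule isCont_inverse_function2[of "g u - 1" "g u" "(g u + a) / 2"])
        (use ga[OF that] gf DERIV_isCont[OF df] in auto)
    then show "isCont g u" by (simp add: fg that)
  qed (use that fg in auto)
  show thesis
  proof
    fix u :: real assume u: "0 < u" "u < U0"
    note gu = ga[OF u] and nz = less_imp_neq[OF f'_neg[OF ga[OF u]]]
    show "0 < q u" using w_neg[OF gu] by (simp add: q_def)
    \<comment> \<open>Chain rule: the factor \<open>deriv f (g u)\<close> from the equation cancels
      against the derivative of \<open>g\<close>, leaving \<open>g u / 2\<close>.\<close>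
    have "(q has_real_derivative - (- (1/2) * g u * deriv f (g u) * inverse (deriv f (g u)))) (at u)"
      unfolding q_def by (intro DERIV_minus DERIV_chain2[OF dw dg] gu u)
    then show "(q has_real_derivative g u / 2) (at u)" using nz by (simp add: mult.assoc)
    have "inverse (deriv f (g u)) = - (u powr (m - 1) / q u)"
      using nz u fg[OF u] by (simp add: q_def w_def field_simps)
    then show "(g has_real_derivative - (u powr (m - 1) / q u)) (at u)" using dg[OF u] by simp
  next
    \<comment> \<open>For \<open>0 < u < f x\<close>, monotonicity of \<open>f\<close> places
      \<open>g u\<close> between \<open>x\<close> and \<open>a\<close>.\<close>
    have ev_g: "eventually (\<lambda>u. x < g u \<and> g u < a) (at_right 0)" if "x < a" for x
      unfolding eventually_at_right_field
    proof (intro exI conjI allI impI)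
      show "0 < f x" using fpos that by simp
      fix u assume u: "0 < u" "u < f x"
      then have "u < U0" using f_less[OF that] by simp
      with u show "g u < a" "x < g u"
        using ga fg f_less_iff[of "g u" x] that by auto
    qed
    show lim_g: "(g \<longlongrightarrow> a) (at_right 0)"
    proof (rule order_tendstoI)
      fix y assume "a < y"
      with ev_g[of "a - 1"] show "eventually (\<lambda>u. g u < y) (at_right 0)"
        by (auto elim: eventually_mono)
    qed (use ev_g in \<open>simp add: eventually_conj_iff\<close>)
    have "filterlim g (at_left a) (at_right 0)"
      using lim_g ev_g[of "a - 1"]
      by (auto simp: filterlim_at elim: eventually_mono)
    then have "((\<lambda>u. w (g u)) \<longlongrightarrow> - (a * V0 / 2)) (at_right 0)"
      by (rule filterlim_compose[OF lim_w])
    then show "(q \<longlongrightarrow> a * V0 / 2) (at_right 0)"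
      unfolding q_def using tendsto_minus by fastforce
  next
    \<comment> \<open>For \<open>x < 0\<close> the flux decreases on \<open>[x, 0]\<close> and dominates \<open>f'\<close> (as \<open>f < 1\<close>), so the total drop
      of \<open>f\<close> there, which is less than 1, is at least \<open>- w x * \<bar>x\<bar>\<close>.\<close>
    have w_lower: "1 / x \<le> w x" if "x < 0" for x
    proof -
      obtain z where z: "x < z" "z < 0" "f 0 - f x = (0 - x) * deriv f z"
        using MVT2[of x 0 f "deriv f"] df \<open>x < 0\<close> \<open>0 < a\<close> by force
      have "f z powr (m - 1) \<le> 1"
        using fpos[of z] f_less[of z] \<open>U0 < 1\<close> \<open>2 \<le> m\<close> z \<open>0 < a\<close> by (intro powr_le1) auto
      then have "deriv f z \<le> w z"
        using f'_neg[of z] z \<open>0 < a\<close> mult_right_mono_neg[of "f z powr (m - 1)" 1 "deriv f z"]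
        by (simp add: w_def)
      also have "w z \<le> w x"
      proof (rule DERIV_nonpos_imp_nonincreasing[OF less_imp_le[OF z(1)]])
        fix y assume "x \<le> y" "y \<le> z"
        then have "y < 0" "y < a" using z \<open>0 < a\<close> by auto
        then have "- (1/2) * y * deriv f y \<le> 0"
          using f'_neg[of y] by (simp add: mult_le_0_iff zero_le_mult_iff)
        then show "\<exists>D. (w has_real_derivative D) (at y) \<and> D \<le> 0"
          using dw[OF \<open>y < a\<close>] by blast
      qed
      finally have "(- x) * deriv f z \<le> (- x) * w x"
        using that by (intro mult_left_mono) auto
      moreover have "- 1 < f 0 - f x"
        using fpos[of 0] f_less[of x] \<open>U0 < 1\<close> \<open>0 < a\<close> that by simp
      ultimately have "x * w x \<le> 1" using z(3) by simp
      then show ?thesis using that by (simp add: field_simps)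
    qed
    have w0: "(w \<longlongrightarrow> 0) at_bot"
    proof (rule tendsto_sandwich)
      show "eventually (\<lambda>x. 1 / x \<le> w x) at_bot"
        using eventually_gt_at_bot[of 0] by eventually_elim (rule w_lower)
      show "eventually (\<lambda>x. w x \<le> 0) at_bot"
        using eventually_gt_at_bot[of a] by eventually_elim (use w_neg in force)
      show "((\<lambda>x::real. 1 / x) \<longlongrightarrow> 0) at_bot"
        by (intro tendsto_divide_0[OF tendsto_const] filterlim_at_bot_imp_at_infinity filterlim_ident)
    qed simp
    have "filterlim g at_bot (at_left U0)"
      unfolding filterlim_at_bot_dense
    proof
      fix Z :: real
      \<comment> \<open>Truncating at 0 ensures \<open>x < a\<close>, where \<open>f\<close> is
        known to be decreasing.\<close>
      define x where "x = min Z 0"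
      have x: "x < a" "x \<le> Z" using \<open>0 < a\<close> by (auto simp: x_def)
      show "eventually (\<lambda>u. g u < Z) (at_left U0)"
        unfolding eventually_at_left_field
      proof (intro exI conjI allI impI)
        show "f x < U0" using f_less x by simp
        fix u assume u: "f x < u" "u < U0"
        then have "0 < u" using fpos[OF x(1)] by simp
        with u show "g u < Z"
          using ga fg f_less_iff[of x "g u"] x by auto
      qed
    qed
    then have "((\<lambda>u. w (g u)) \<longlongrightarrow> 0) (at_left U0)"
      by (rule filterlim_compose[OF w0])
    then show "(q \<longlongrightarrow> 0) (at_left U0)"
      unfolding q_def using tendsto_minus by fastforce
  qed
qed

theorem theorem6p2:
  fixes U0 V0 m1 m2 a1 a2 :: real and f1 f2 :: "real \<Rightarrow> real"
  assumes "0 < U0" and "U0 < 1" and "0 < V0"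
    and "2 \<le> m1" and "2 \<le> m2"
    and "free_boundary_solution U0 V0 m1 f1 a1"
    and "free_boundary_solution U0 V0 m2 f2 a2"
    and "m1 > m2"
  shows "0 < a1 \<and> a1 < a2"
proof -
  have "0 < a1"
    using assms(6) by (simp add: free_boundary_solution_def)
  moreover have "a1 < a2"
  proof (rule ccontr)
    assume "\<not> a1 < a2"
    obtain g1 q1 where q1:
      "\<And>u. 0 < u \<Longrightarrow> u < U0 \<Longrightarrow> 0 < q1 u"
      "\<And>u. 0 < u \<Longrightarrow> u < U0 \<Longrightarrow> (q1 has_real_derivative g1 u / 2) (at u)"
      "\<And>u. 0 < u \<Longrightarrow> u < U0 \<Longrightarrow> (g1 has_real_derivative - (u powr (m1 - 1) / q1 u)) (at u)"
      "(g1 \<longlongrightarrow> a1) (at_right 0)" "(q1 \<longlongrightarrow> a1 * V0 / 2) (at_right 0)" "(q1 \<longlongrightarrow> 0) (at_left U0)"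
      by (rule hodograph[OF assms(1-3,6,4)]) (rule that)
    obtain g2 q2 where q2:
      "\<And>u. 0 < u \<Longrightarrow> u < U0 \<Longrightarrow> 0 < q2 u"
      "\<And>u. 0 < u \<Longrightarrow> u < U0 \<Longrightarrow> (q2 has_real_derivative g2 u / 2) (at u)"
      "\<And>u. 0 < u \<Longrightarrow> u < U0 \<Longrightarrow> (g2 has_real_derivative - (u powr (m2 - 1) / q2 u)) (at u)"
      "(g2 \<longlongrightarrow> a2) (at_right 0)" "(q2 \<longlongrightarrow> a2 * V0 / 2) (at_right 0)" "(q2 \<longlongrightarrow> 0) (at_left U0)"
      by (rule hodograph[OF assms(1-3,7,5)]) (rule that)
    define d where "d u = q1 u - q2 u" for u
    define d' where "d' u = g1 u / 2 - g2 u / 2" for u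
    define d'' where "d'' u = (u powr (m2 - 1) / q2 u - u powr (m1 - 1) / q1 u) / 2" for u
    have dd: "(d has_real_derivative d' u) (at u)"
      and dd': "(d' has_real_derivative d'' u) (at u)" if "0 < u" "u < U0" for u
    proof -
      show "(d has_real_derivative d' u) (at u)"
        unfolding d_def d'_def by (intro DERIV_diff q1 q2 that)
      show "(d' has_real_derivative d'' u) (at u)"
        using DERIV_diff[OF DERIV_cdivide[OF q1(3)[OF that], of 2] DERIV_cdivide[OF q2(3)[OF that], of 2]]
        unfolding d'_def d''_def by (simp add: diff_divide_distrib)
    qed
    \<comment> \<open>Cross-multiplication after factoring out \<open>u powr (m2 - 1)\<close>. This
      criterion is weaker than \<open>0 \<le> d u\<close>, so it can be applied near 0 before the
      sign of \<open>d\<close> is known.\<close>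
    have d''_pos: "0 < d'' u" if "0 < u" "u < U0" "u powr (m1 - m2) * q2 u < q1 u" for u
    proof -
      have "u powr (m1 - 1) * q2 u = u powr (m2 - 1) * (u powr (m1 - m2) * q2 u)"
        by (simp flip: powr_add mult.assoc)
      also have "\<dots> < u powr (m2 - 1) * q1 u" using that by simp
      finally show ?thesis
        using q1(1) q2(1) that by (simp add: d''_def field_simps)
    qed
    have d''_pos': "0 < d'' u" if "0 < u" "u < U0" "0 \<le> d u" for u
    proof (rule d''_pos[OF that(1,2)])
      have "u powr (m1 - m2) < 1"
        using powr_less_mono2[of "m1 - m2" u 1] that \<open>U0 < 1\<close> \<open>m1 > m2\<close> by simp
      then have "u powr (m1 - m2) * q2 u < 1 * q2 u"
        using q2(1) that by (intro mult_strict_right_mono) auto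
      then show "u powr (m1 - m2) * q2 u < q1 u"
        using that by (simp add: d_def)
    qed
    \<comment> \<open>Because \<open>m1 > m2\<close> the factor vanishes at 0, while
      \<open>q1\<close> tends to a positive limit. Hence the criterion holds near 0 even if
      \<open>a1 = a2\<close>, where \<open>d\<close> itself tends to 0.\<close>
    have "((\<lambda>u. u powr (m1 - m2)) \<longlongrightarrow> 0 powr (m1 - m2)) (at_right (0::real))"
      using \<open>m1 > m2\<close>
      by (intro tendsto_powr2 tendsto_ident_at tendsto_const) (auto simp: eventually_at_right_field intro: exI[of _ 1])
    then have "((\<lambda>u. q1 u - u powr (m1 - m2) * q2 u) \<longlongrightarrow> a1 * V0 / 2 - 0 * (a2 * V0 / 2)) (at_right 0)"
      by (intro tendsto_diff tendsto_mult q1 q2) simp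
    then have "eventually (\<lambda>u. 0 < q1 u - u powr (m1 - m2) * q2 u) (at_right 0)"
      using \<open>0 < a1\<close> \<open>0 < V0\<close> by (elim order_tendstoD) simp
    then obtain r0 where "0 < r0" and r0: "\<And>u. 0 < u \<Longrightarrow> u < r0 \<Longrightarrow> u powr (m1 - m2) * q2 u < q1 u"
      unfolding eventually_at_right_field by auto
    define r where "r = min r0 U0"
    have r: "0 < r" "r \<le> U0" using \<open>0 < r0\<close> \<open>0 < U0\<close> by (auto simp: r_def)
    \<comment> \<open>Under \<open>a1 \<ge> a2\<close> both \<open>d'\<close> and \<open>d\<close>
      have nonnegative limits at 0, so positivity passes from \<open>d''\<close> to
      \<open>d'\<close> and then to \<open>d\<close>.\<close>
    have "(d' \<longlongrightarrow> a1 / 2 - a2 / 2) (at_right 0)"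
      unfolding d'_def by (intro tendsto_intros q1 q2) auto
    then have d'_pos: "0 < d' u" if "0 < u" "u < r" for u
      by (rule pos_of_deriv_pos_at_right_0[where h' = d'' and r = r])
        (use \<open>\<not> a1 < a2\<close> dd' d''_pos r0 that in \<open>auto simp: r_def\<close>)
    have "(d \<longlongrightarrow> a1 * V0 / 2 - a2 * V0 / 2) (at_right 0)"
      unfolding d_def by (intro tendsto_diff q1 q2)
    then have d_pos: "0 < d u" if "0 < u" "u < r" for u
      by (rule pos_of_deriv_pos_at_right_0[where h' = d' and r = r])
        (use \<open>\<not> a1 < a2\<close> \<open>0 < V0\<close> dd d'_pos r that in \<open>auto simp: field_simps\<close>)
    \<comment> \<open>Two points where \<open>d\<close> is increasing: \<open>d x < d y\<close>
      rules out a maximum at the left end of \<open>{x..t}\<close>, and \<open>t\<close> is chosen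
      near \<open>U0\<close> with \<open>d t < d y\<close> to rule out the right end.\<close>
    define x where "x = r / 3"
    define y where "y = r / 2"
    have xy: "0 < x" "x < y" "y < r" using r by (auto simp: x_def y_def)
    have "d x < d y"
      by (rule DERIV_pos_imp_increasing[OF \<open>x < y\<close>]) (use dd d'_pos xy r in force)
    have "(d \<longlongrightarrow> 0 - 0) (at_left U0)"
      unfolding d_def by (intro tendsto_diff q1 q2)
    then have "eventually (\<lambda>u. d u < d y) (at_left U0)"
      using d_pos[of y] xy by (intro order_tendstoD) auto
    moreover have "eventually (\<lambda>u. u \<in> {y<..<U0}) (at_left U0)"
      using xy r by (intro eventually_at_left_real) auto
    ultimately have "eventually (\<lambda>u. d u < d y \<and> u \<in> {y<..<U0}) (at_left U0)"
      by (rule eventually_conj)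
    then obtain t where t: "d t < d y" "y < t" "t < U0"
      using eventually_happens'[of "at_left U0"] by auto
    have "continuous_on {x..t} d"
      by (intro continuous_at_imp_continuous_on ballI DERIV_isCont[OF dd]) (use xy t in auto)
    then obtain z where z: "z \<in> {x..t}" "\<And>u. u \<in> {x..t} \<Longrightarrow> d u \<le> d z"
      using continuous_attains_sup[OF compact_Icc, of x t d] xy t by force
    have "d y \<le> d z" using z(2)[of y] xy t by simp
    then have "z \<noteq> x" "z \<noteq> t" using \<open>d x < d y\<close> t by auto
    then have z': "x < z" "z < t" using z by auto
    show False
    proof (rule no_interior_max[of x t d d'])
      show "(d' has_real_derivative d'' z) (at z)" using dd' z' xy t by simp
      \<comment> \<open>The maximal value is at least \<open>d y > 0\<close>, so the convexity for
        nonnegative \<open>d\<close> applies at \<open>z\<close>.\<close>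
      show "0 < d'' z"
        using d''_pos' z' xy t \<open>d y \<le> d z\<close> d_pos[of y] by simp
    qed (use dd xy t z z' in auto)
  qed
  ultimately show ?thesis by simp
qed

end
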